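(* Let $(X,\rho)$ be a compact metric space, let $d\ge 1$, let $T:\mathbb{Z}^d\times X\to X$ be a continuous $\mathbb{Z}^d$-action on $X$, and let $k\in\{1,\dots,2^d\}$. If the induced action $(Sub_X,\hat{T})$ on the hyperspace $Sub_X$ is $k$-type transitive, then the $\mathbb{Z}^d$-action $(X,T)$ is $k$-type transitive.
   Context: A $\mathbb{Z}^d$-action on $X$ is a continuous map $T:\mathbb{Z}^d\times X\to X$, written $T^n(x)=T(n,x)$, with $T^0(x)=x$ and $T^{n+m}(x)=T^n(T^m(x))$ for all $x\in X$, $n,m\in\mathbb{Z}^d$. For $k\in\{1,\dots,2^d\}$ let $k^b=(k^b_1,\dots,k^b_d)\in\{0,1\}^d$ be defined by $k-1=\sum_{i=1}^d k^b_i 2^{i-1}$. For $x,y\in\mathbb{Z}^d$, write $x\ge^k y$ if $(-1)^{k^b_i}x_i\ge(-1)^{k^b_i}y_i$ for all $i=1,\dots,d$. The hyperspace $Sub_X$ is the set of all non-empty closed (equivalently, non-empty compact) subsets of $X$, endowed with the Hausdorff metric $H(A,B)=\max\{\sup_{a\in A}\rho(a,B),\sup_{b\in B}\rho(b,A)\}$, where $\rho(x,S)=\inf_{s\in S}\rho(x,s)$; it is a compact metric space. The induced $\mathbb{Z}^d$-action $\hat{T}$ on $Sub_X$ is $\hat{T}^m(A)=T^m(A)=\{T^m(x):x\in A\}$. A $\mathbb{Z}^d$-action $T$ on a space $X$ is $k$-type transitive if for any non-empty open $U,V\subseteq X$ there is $m\in\mathbb{Z}^d$ with $m\ge^k 0$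 and $T^m(U)\cap V\ne\emptyset$. The same definition applies to $(Sub_X,\hat{T})$. *)

theory Defs
  imports "HOL-Analysis.Analysis"
begin

text \<open>
  Elements of \<open>\<int>\<^sup>d\<close> have coordinates indexed by \<open>1, \<dots>, d\<close>; they are represented by functions on
  \<open>nat\<close> vanishing at all other indices, so that the group operations are pointwise.
\<close>

definition Zd :: "nat \<Rightarrow> (nat \<Rightarrow> int) set" where
  "Zd d = {n. \<forall>i. i \<notin> {1..d} \<longrightarrow> n i = 0}"

definition Zd_zero :: "nat \<Rightarrow> int" where
  "Zd_zero = (\<lambda>i. 0)"

definition Zd_add :: "(nat \<Rightarrow> int) \<Rightarrow> (nat \<Rightarrow> int) \<Rightarrow> nat \<Rightarrow> int" where
  "Zd_add n m = (\<lambda>i. n i + m i)"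

text \<open>As usual, \<open>\<int>\<^sup>d\<close> carries the discrete topology.\<close>

definition Zd_action :: "nat \<Rightarrow> 'a topology \<Rightarrow> ((nat \<Rightarrow> int) \<Rightarrow> 'a \<Rightarrow> 'a) \<Rightarrow> bool" where
  "Zd_action d X T \<longleftrightarrow>
     continuous_map (prod_topology (discrete_topology (Zd d)) X) X (\<lambda>(n, x). T n x) \<and>
     (\<forall>x \<in> topspace X. T Zd_zero x = x) \<and>
     (\<forall>x \<in> topspace X. \<forall>n \<in> Zd d. \<forall>m \<in> Zd d. T (Zd_add n m) x = T n (T m x))"

definition is_kbits :: "nat \<Rightarrow> nat \<Rightarrow> (nat \<Rightarrow> nat) \<Rightarrow> bool" where
  "is_kbits d k b \<longleftrightarrow>
     (\<forall>i \<in> {1..d}. b i \<in> {0, 1}) \<and> (\<forall>i. i \<notin> {1..d} \<longrightarrow> b i = 0) \<and>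
     k - 1 = (\<Sum>i = 1..d. b i * 2 ^ (i - 1))"

definition kbits :: "nat \<Rightarrow> nat \<Rightarrow> nat \<Rightarrow> nat" where
  "kbits d k = (THE b. is_kbits d k b)"

lemma binary_digits_ex1:
  "n < 2 ^ d \<Longrightarrow> \<exists>!b::nat \<Rightarrow> nat. (\<forall>i \<in> {1..d}. b i \<in> {0, 1}) \<and>
     (\<forall>i. i \<notin> {1..d} \<longrightarrow> b i = 0) \<and> n = (\<Sum>i = 1..d. b i * 2 ^ (i - 1))"
  (is "_ \<Longrightarrow> \<exists>!b. ?P d n b")
proof (induction d arbitrary: n)
  case 0
  show ?case
  proof (rule ex1I[of _ "\<lambda>_. 0"])
    show "?P 0 n (\<lambda>_. 0)" using 0 by simp
  next
    fix b assume "?P 0 n b"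
    then show "b = (\<lambda>_. 0)" by auto
  qed
next
  case (Suc d)
  have bound: "m < 2 ^ d" if "?P d m b" for m :: nat and b :: "nat \<Rightarrow> nat"
    using that
  proof (induction d arbitrary: m b)
    case 0
    then show ?case by simp
  next
    case (Suc d)
    let ?b = "b(Suc d := 0)"
    have "?P d (\<Sum>i = 1..d. b i * 2 ^ (i - 1)) ?b" using Suc.prems by auto
    from Suc.IH[OF this] have "(\<Sum>i = 1..d. b i * 2 ^ (i - 1)) < 2 ^ d" .
    moreover have "b (Suc d) * 2 ^ d \<le> 1 * 2 ^ d"
      using Suc.prems by (intro mult_right_mono) (auto dest: bspec[of _ _ "Suc d"])
    moreover have "m = (\<Sum>i = 1..d. b i * 2 ^ (i - 1)) + b (Suc d) * 2 ^ d"
      using Suc.prems by simp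
    ultimately show ?case unfolding power_Suc by linarith
  qed
  define c where "c = n div 2 ^ d"
  define r where "r = n mod 2 ^ d"
  have n: "n = r + c * 2 ^ d" unfolding c_def r_def by (rule mod_div_mult_eq[symmetric])
  have r: "r < 2 ^ d" by (simp add: r_def)
  have c: "c \<in> {0, 1}"
  proof -
    have "c < 2" using Suc.prems by (simp add: c_def less_mult_imp_div_less)
    then show ?thesis by auto
  qed
  obtain b where b: "?P d r b" and b_uniq: "\<forall>b'. ?P d r b' \<longrightarrow> b' = b"
    using Suc.IH[OF r] by (rule ex1E)
  show ?case
  proof (rule ex1I[of _ "b(Suc d := c)"])
    show "?P (Suc d) n (b(Suc d := c))" using b c n by auto
  next
    fix b' assume b': "?P (Suc d) n b'"
    define s where "s = (\<Sum>i = 1..d. b' i * 2 ^ (i - 1))"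
    have P: "?P d s (b'(Suc d := 0))" using b' by (auto simp: s_def)
    then have s: "s < 2 ^ d" by (rule bound)
    have n': "n = s + b' (Suc d) * 2 ^ d" using b' by (simp add: s_def)
    have "s = r" using s n' by (simp add: r_def)
    moreover have "b' (Suc d) = c" using s n' by (simp add: c_def)
    ultimately have "b'(Suc d := 0) = b" using b_uniq[rule_format] P by simp
    then show "b' = b(Suc d := c)" using \<open>b' (Suc d) = c\<close> by auto
  qed
qed

lemma is_kbits_kbits:
  assumes "k \<in> {1..2 ^ d}"
  shows "is_kbits d k (kbits d k)"
proof -
  have "k - 1 < 2 ^ d" using assms by auto
  then have "\<exists>!b. is_kbits d k b" unfolding is_kbits_def by (rule binary_digits_ex1)
  then show ?thesis unfolding kbits_def by (rule theI')
qed

definition ge_k :: "nat \<Rightarrow> nat \<Rightarrow> (nat \<Rightarrow> int) \<Rightarrow> (nat \<Rightarrow> int) \<Rightarrow> bool" where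
  "ge_k d k x y \<longleftrightarrow>
     (\<forall>i \<in> {1..d}. (- 1) ^ kbits d k i * x i \<ge> (- 1) ^ kbits d k i * y i)"

definition k_type_transitive ::
    "nat \<Rightarrow> nat \<Rightarrow> 'a topology \<Rightarrow> ((nat \<Rightarrow> int) \<Rightarrow> 'a \<Rightarrow> 'a) \<Rightarrow> bool" where
  "k_type_transitive d k X T \<longleftrightarrow>
     (\<forall>U V. openin X U \<and> U \<noteq> {} \<and> openin X V \<and> V \<noteq> {} \<longrightarrow>
        (\<exists>m \<in> Zd d. ge_k d k m Zd_zero \<and> T m ` U \<inter> V \<noteq> {}))"

definition Sub :: "'a topology \<Rightarrow> 'a set set" where
  "Sub X = {A. closedin X A \<and> A \<noteq> {}}"

definition dist_to_set :: "('a \<Rightarrow> 'a \<Rightarrow> real) \<Rightarrow> 'a \<Rightarrow> 'a set \<Rightarrow> real" where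
  "dist_to_set \<rho> x S = (INF s \<in> S. \<rho> x s)"

text \<open>
  Infima and suprema are taken in \<open>real\<close>; they are the intended ones for nonempty bounded sets, in
  particular on the hyperspace of a compact metric space. Outside the hyperspace the value is set
  to \<open>0\<close>, because \<^locale>\<open>Metric_space\<close> requires nonnegativity and symmetry everywhere.
\<close>

definition hausdorff_metric :: "'a set \<Rightarrow> ('a \<Rightarrow> 'a \<Rightarrow> real) \<Rightarrow> 'a set \<Rightarrow> 'a set \<Rightarrow> real" where
  "hausdorff_metric X \<rho> A B =
     (if A \<in> Sub (Metric_space.mtopology X \<rho>) \<and> B \<in> Sub (Metric_space.mtopology X \<rho>)
      then max (SUP a \<in> A. dist_to_set \<rho> a B) (SUP b \<in> B. dist_to_set \<rho> b A)
      else 0)"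

definition hyperspace :: "'a set \<Rightarrow> ('a \<Rightarrow> 'a \<Rightarrow> real) \<Rightarrow> 'a set topology" where
  "hyperspace X \<rho> =
     Metric_space.mtopology (Sub (Metric_space.mtopology X \<rho>)) (hausdorff_metric X \<rho>)"

definition induced_action ::
    "((nat \<Rightarrow> int) \<Rightarrow> 'a \<Rightarrow> 'a) \<Rightarrow> (nat \<Rightarrow> int) \<Rightarrow> 'a set \<Rightarrow> 'a set" where
  "induced_action T m A = T m ` A"

text \<open>
  \<^const>\<open>Metric_space.mtopology\<close> is only meaningful for an actual metric, which the following lemma
  provides.
\<close>

lemma Metric_space_Sub_hausdorff:
  assumes X: "Metric_space X \<rho>" and cpt: "compact_space (Metric_space.mtopology X \<rho>)"
  shows "Metric_space (Sub (Metric_space.mtopology X \<rho>)) (hausdorff_metric X \<rho>)"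
proof -
  interpret Metric_space X \<rho> by (rule X)
  have sub: "A \<subseteq> X" "A \<noteq> {}" "closedin mtopology A" if "A \<in> Sub mtopology" for A
    using that closedin_subset[of mtopology A] by (auto simp: Sub_def)
  have "mbounded X"
    using cpt compactin_imp_mbounded[of X] by (simp add: compact_space_def)
  then obtain K where K: "\<And>x y. x \<in> X \<Longrightarrow> y \<in> X \<Longrightarrow> \<rho> x y \<le> K"
    unfolding mbounded_alt by blast
  let ?D = "dist_to_set \<rho>" and ?H = "hausdorff_metric X \<rho>"
  have bdd: "bdd_below (\<rho> x ` A)" for x A by (rule bdd_belowI2[of _ 0]) simp
  have D_le: "?D x A \<le> \<rho> x a" if "a \<in> A" for x a A
    unfolding dist_to_set_def by (rule cINF_lower[OF bdd that])
  have D_ge: "r \<le> ?D x A" if "A \<noteq> {}" "\<And>a. a \<in> A \<Longrightarrow> r \<le> \<rho> x a" for x A r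
    unfolding dist_to_set_def using that by (rule cINF_greatest)
  have D_nonneg: "0 \<le> ?D x A" if "A \<noteq> {}" for x A
    using that by (intro D_ge) auto
  have D_bdd: "bdd_above ((\<lambda>a. ?D a B) ` A)" if "A \<in> Sub mtopology" "B \<in> Sub mtopology" for A B
  proof -
    obtain b where "b \<in> B" using sub(2)[OF \<open>B \<in> Sub mtopology\<close>] by blast
    moreover have "A \<subseteq> X" "B \<subseteq> X" using that sub(1) by blast+
    ultimately have "?D a B \<le> K" if "a \<in> A" for a
      using that by (intro order_trans[OF D_le K]) auto
    then show ?thesis by (intro bdd_aboveI2) auto
  qed
  have H_ub: "?D a B \<le> ?H A B" if "A \<in> Sub mtopology" "B \<in> Sub mtopology" "a \<in> A" for A B a
    using cSUP_upper[OF that(3) D_bdd[OF that(1,2)]] that(1,2)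
    by (simp add: hausdorff_metric_def)
  have H_comm: "?H A B = ?H B A" for A B by (simp add: hausdorff_metric_def max.commute)
  have H_lub: "?H A B \<le> r"
    if "A \<in> Sub mtopology" "B \<in> Sub mtopology"
      "\<And>a. a \<in> A \<Longrightarrow> ?D a B \<le> r" "\<And>b. b \<in> B \<Longrightarrow> ?D b A \<le> r" for A B r
    using that sub(2)[OF that(1)] sub(2)[OF that(2)]
    by (simp add: hausdorff_metric_def cSUP_least)
  have H_nonneg: "0 \<le> ?H A B" for A B
  proof (cases "A \<in> Sub mtopology \<and> B \<in> Sub mtopology")
    case True
    then obtain a where a: "a \<in> A" using sub(2)[of A] by blast
    have "0 \<le> ?D a B" using True sub(2)[of B] by (intro D_nonneg) blast
    also have "?D a B \<le> ?H A B" using True a by (intro H_ub) blast+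
    finally show ?thesis by simp
  next
    case False
    then show ?thesis by (simp only: hausdorff_metric_def if_False)
  qed
  have D_zero: "a \<in> B" if "B \<in> Sub mtopology" "a \<in> X" "?D a B \<le> 0" for a B
  proof (rule ccontr)
    assume "a \<notin> B"
    moreover have "openin mtopology (X - B)" using sub(3)[OF that(1)] by (simp add: closedin_def)
    ultimately obtain r where "r > 0" "mball a r \<subseteq> X - B"
      using \<open>a \<in> X\<close> unfolding openin_mtopology by (metis DiffI)
    moreover have "B \<subseteq> X" using sub(1)[OF that(1)] .
    ultimately have "r \<le> \<rho> a b" if "b \<in> B" for b
      using that \<open>a \<in> X\<close> by (meson DiffD2 in_mball not_le subsetD)
    then have "r \<le> ?D a B" using sub(2)[OF that(1)] by (intro D_ge) auto
    then show False using that(3) \<open>r > 0\<close> by simp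
  qed
  have D_tri: "?D a C \<le> ?H A B + ?H B C"
    if "A \<in> Sub mtopology" "B \<in> Sub mtopology" "C \<in> Sub mtopology" "a \<in> A" for A B C a
  proof -
    have X: "a \<in> X" "B \<subseteq> X" "C \<subseteq> X" and C: "C \<noteq> {}" using that sub(1,2) by blast+
    have step: "?D a C - ?H B C \<le> \<rho> a b" if "b \<in> B" for b
    proof -
      have "?D a C - \<rho> a b \<le> ?D b C"
      proof (rule D_ge)
        show "C \<noteq> {}" by (rule C)
        fix c assume "c \<in> C"
        then have "?D a C \<le> \<rho> a c" "\<rho> a c \<le> \<rho> a b + \<rho> b c"
          using D_le triangle[of a b c] X \<open>b \<in> B\<close> by blast+
        then show "?D a C - \<rho> a b \<le> \<rho> b c" by simp
      qed
      moreover have "?D b C \<le> ?H B C" 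
        using H_ub that \<open>B \<in> Sub mtopology\<close> \<open>C \<in> Sub mtopology\<close> by blast
      ultimately show ?thesis by simp
    qed
    have "?D a C - ?H B C \<le> ?D a B" using sub(2)[OF that(2)] step by (rule D_ge)
    moreover have "?D a B \<le> ?H A B" using H_ub that by blast
    ultimately show ?thesis by simp
  qed
  show ?thesis
  proof
    fix A B
    show "0 \<le> ?H A B"
      by (rule H_nonneg)
    show "?H A B = ?H B A" by (rule H_comm)
  next
    fix A B assume AB: "A \<in> Sub mtopology" "B \<in> Sub mtopology"
    show "?H A B = 0 \<longleftrightarrow> A = B"
    proof
      assume "?H A B = 0"
      then have "A \<subseteq> B" "B \<subseteq> A"
        using D_zero H_ub AB H_comm[of A B] sub(1)[OF AB(1)] sub(1)[OF AB(2)]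
        by (metis subsetI subsetD)+
      then show "A = B" by blast
    next
      assume "A = B"
      have "?D a A \<le> 0" if "a \<in> A" for a
        using D_le[OF that, of a] that sub(1)[OF AB(1)] by (simp add: subsetD)
      then have "?H A A \<le> 0" using AB by (intro H_lub) auto
      moreover have "0 \<le> ?H A A" by (rule H_nonneg)
      ultimately show "?H A B = 0" using \<open>A = B\<close> by simp
    qed
  next
    fix A B C assume ABC: "A \<in> Sub mtopology" "B \<in> Sub mtopology" "C \<in> Sub mtopology"
    show "?H A C \<le> ?H A B + ?H B C"
    proof (rule H_lub[OF ABC(1,3)])
      show "?D a C \<le> ?H A B + ?H B C" if "a \<in> A" for a using D_tri ABC that by blast
      show "?D c A \<le> ?H A B + ?H B C" if "c \<in> C" for c
        using D_tri[OF ABC(3,2,1) that] by (simp add: H_comm[of C B] H_comm[of B A])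
    qed
  qed
qed

end

theory Submission
  imports Defs
begin

text \<open>
  Points embed in the hyperspace as singletons, and Hausdorff balls around singletons see the
  topology of \<open>X\<close>: a closed set at Hausdorff distance less than \<open>r\<close> from \<open>{u}\<close> lies entirely inside
  the \<open>r\<close>-ball around \<open>u\<close> (lemma \<open>mball_singleton_hyperspace_subset\<close>). Given nonempty open sets
  \<open>U\<close> and \<open>V\<close>, choose points \<open>u\<close>, \<open>v\<close> and balls around them inside \<open>U\<close> and \<open>V\<close>. Transitivity of the
  induced action, applied to the Hausdorff balls of the same radii around \<open>{u}\<close> and \<open>{v}\<close>, gives a
  nonempty closed set \<open>A \<subseteq> U\<close> and a time \<open>m\<close> of the required type such that \<open>T\<^sup>m(A) \<subseteq> V\<close>. Any point
  of \<open>A\<close> then witnesses that \<open>T\<^sup>m(U)\<close> meets \<open>V\<close>.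
\<close>

lemma (in Metric_space) singleton_in_Sub:
  assumes "u \<in> M"
  shows "{u} \<in> Sub mtopology"
  using assms by (simp add: Sub_def closedin_Hausdorff_sing_eq Hausdorff_space_mtopology)

text \<open>
  Since the infimum over \<open>{u}\<close> is \<open>d b u\<close> itself, the supremum over \<open>b \<in> B\<close> dominates each such
  distance; boundedness of the space makes this real supremum a genuine upper bound.
\<close>

lemma (in Metric_space) dist_le_hausdorff_singleton:
  assumes bounded: "mbounded M" and u: "u \<in> M" and B: "B \<in> Sub mtopology" and b: "b \<in> B"
  shows "d u b \<le> hausdorff_metric M d {u} B"
proof -
  have "B \<subseteq> M"
    using B closedin_subset[of mtopology B] by (simp add: Sub_def)
  obtain K where K: "\<And>x y. x \<in> M \<Longrightarrow> y \<in> M \<Longrightarrow> d x y \<le> K"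
    using bounded unfolding mbounded_alt by blast
  have "bdd_above ((\<lambda>x. d x u) ` B)"
    using K u \<open>B \<subseteq> M\<close> by (intro bdd_aboveI2[of _ _ K]) blast
  then have "d b u \<le> (SUP x \<in> B. d x u)"
    using b by (intro cSUP_upper)
  then show ?thesis
    using singleton_in_Sub[OF u] B
    by (simp add: hausdorff_metric_def dist_to_set_def commute[of u b])
qed

lemma (in Metric_space) mball_singleton_hyperspace_subset:
  assumes cpt: "compact_space mtopology" and u: "u \<in> M"
    and A: "A \<in> Metric_space.mball (Sub mtopology) (hausdorff_metric M d) {u} r"
  shows "A \<subseteq> mball u r"
proof
  interpret H: Metric_space "Sub mtopology" "hausdorff_metric M d"
    using Metric_space_axioms cpt by (rule Metric_space_Sub_hausdorff)
  fix a assume a: "a \<in> A"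
  have Sub: "A \<in> Sub mtopology" and less: "hausdorff_metric M d {u} A < r"
    using A by (simp_all add: H.in_mball)
  have "mbounded M"
    using cpt compactin_imp_mbounded[of M] by (simp add: compact_space_def)
  then have "d u a < r"
    using dist_le_hausdorff_singleton[OF _ u Sub a] less by simp
  moreover have "a \<in> M"
    using Sub a closedin_subset[of mtopology A] by (auto simp: Sub_def)
  ultimately show "a \<in> mball u r"
    using u by simp
qed

theorem theorem3p1:
  fixes X :: "'a set" and \<rho> :: "'a \<Rightarrow> 'a \<Rightarrow> real"
    and T :: "(nat \<Rightarrow> int) \<Rightarrow> 'a \<Rightarrow> 'a" and d k :: nat
  assumes "Metric_space X \<rho>"
    and "compact_space (Metric_space.mtopology X \<rho>)"
    and "d \<ge> 1"
    and "Zd_action d (Metric_space.mtopology X \<rho>) T"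
    and "k \<in> {1..2 ^ d}"
    and "k_type_transitive d k (hyperspace X \<rho>) (induced_action T)"
  shows "k_type_transitive d k (Metric_space.mtopology X \<rho>) T"
proof -
  interpret Metric_space X \<rho> by (rule assms(1))
  interpret H: Metric_space "Sub mtopology" "hausdorff_metric X \<rho>"
    using assms(1,2) by (rule Metric_space_Sub_hausdorff)
  have small_ball: "\<exists>W. openin (hyperspace X \<rho>) W \<and> W \<noteq> {} \<and> (\<forall>A \<in> W. A \<noteq> {} \<and> A \<subseteq> U)"
    if U: "openin mtopology U" "U \<noteq> {}" for U
  proof -
    obtain u where u: "u \<in> U"
      using U(2) by blast
    then obtain r where r: "r > 0" "mball u r \<subseteq> U" and "u \<in> X"
      using U(1) unfolding openin_mtopology by blast
    let ?W = "H.mball {u} r"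
    have "openin (hyperspace X \<rho>) ?W"
      unfolding hyperspace_def by (rule H.openin_mball)
    moreover have "?W \<noteq> {}"
      using singleton_in_Sub[OF \<open>u \<in> X\<close>] r(1) H.centre_in_mball_iff[of "{u}" r] by force
    moreover have "A \<noteq> {} \<and> A \<subseteq> U" if "A \<in> ?W" for A
    proof
      have "A \<in> Sub mtopology"
        using that by simp
      then show "A \<noteq> {}"
        by (simp add: Sub_def)
      show "A \<subseteq> U"
        using mball_singleton_hyperspace_subset[OF assms(2) \<open>u \<in> X\<close> that] r(2) by blast
    qed
    ultimately show ?thesis
      by (intro exI[of _ ?W] conjI ballI) simp_all
  qed
  show ?thesis
    unfolding k_type_transitive_def
  proof (intro allI impI)
    fix U V
    assume UV: "openin mtopology U \<and> U \<noteq> {} \<and> openin mtopology V \<and> V \<noteq> {}"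
    obtain P where P: "openin (hyperspace X \<rho>) P" "P \<noteq> {}" "\<And>A. A \<in> P \<Longrightarrow> A \<noteq> {} \<and> A \<subseteq> U"
      using small_ball[of U] UV by metis
    obtain Q where Q: "openin (hyperspace X \<rho>) Q" "Q \<noteq> {}" "\<And>A. A \<in> Q \<Longrightarrow> A \<noteq> {} \<and> A \<subseteq> V"
      using small_ball[of V] UV by metis
    obtain m where m: "m \<in> Zd d" "ge_k d k m Zd_zero" "induced_action T m ` P \<inter> Q \<noteq> {}"
      using assms(6)[unfolded k_type_transitive_def, rule_format, of P Q] P(1,2) Q(1,2) by auto
    then obtain A where "A \<in> P" "T m ` A \<in> Q"
      by (auto simp: induced_action_def)
    then have "A \<noteq> {}" "A \<subseteq> U" "T m ` A \<subseteq> V"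
      using P(3) Q(3) by blast+
    then have "T m ` U \<inter> V \<noteq> {}"
      by blast
    then show "\<exists>m \<in> Zd d. ge_k d k m Zd_zero \<and> T m ` U \<inter> V \<noteq> {}"
      using m(1,2) by blast
  qed
qed

end
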